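(* Let $m\geq 1$ be a natural number and let $\mathcal V$ be an $m$-permutable variety. Then $\mathcal V$ satisfies the congruence identity $(X_m)$; that is, for every algebra $\mathbf A\in\mathcal V$ and all congruences $\alpha,\beta,\gamma,\delta$ of $\mathbf A$, $$\alpha ( \beta \circ \alpha ( \gamma \circ \alpha ( \beta \circ \dots \alpha ( \gamma^\bullet \circ \alpha ( \beta^\bullet \circ \alpha \delta \circ \beta^\bullet) \circ \gamma^\bullet) \ldots \circ \beta )\circ \gamma) \circ \beta ) = \alpha ( \gamma \circ \alpha ( \beta \circ \alpha ( \gamma \circ \dots \alpha ( \beta^\bullet \circ \alpha ( \gamma^\bullet \circ \alpha \delta \circ \gamma^\bullet) \circ \beta^\bullet) \ldots \circ \gamma )\circ \beta ) \circ \gamma ),$$ with exactly $m$ open brackets (and exactly $m$ closed brackets) on each side, where $\beta^\bullet=\beta$, $\gamma^\bullet=\gamma$ if $m$ is odd, and $\beta^\bullet=\gamma$, $\gamma^\bullet=\beta$ if $m$ is even. Explicitly: put $\theta_i=\beta$ and $\theta'_i=\gamma$ for $i$ even, and $\theta_i=\gamma$ and $\theta'_i=\beta$ for $i$ odd. Let $L_m=L'_m=\alpha\cap\delta$ and, for $i=m-1,m-2,\dots,0$, let $L_i=\alpha\cap(\theta_i\circ L_{i+1}\circ\theta_i)$ and $L'_i=\alpha\cap(\theta'_i\circ L'_{i+1}\circ\theta'_i)$. Then $L_0=L'_0$.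
   Context: Juxtaposition of relations denotes intersection (so $\alpha\delta=\alpha\cap\delta$ and $\alpha(\cdots)=\alpha\cap(\cdots)$), and $\circ$ denotes relational product: $a\,(R\circ S)\,b$ iff there is $c$ with $a\,R\,c$ and $c\,S\,b$. For congruences $\alpha,\beta$, $\alpha\circ_n\beta$ denotes $\alpha\circ\beta\circ\alpha\circ\beta\circ\cdots$ with $n-1$ occurrences of $\circ$ (i.e. $n$ factors). Two congruences $\alpha,\beta$ $m$-permute if $\alpha\circ_m\beta=\beta\circ_m\alpha$. An algebra is $m$-permutable if every pair of its congruences $m$-permute, and a variety (equational class of algebras) is $m$-permutable if every algebra in it is $m$-permutable. Equivalently, $(a_0,b_0)$ belongs to the left-hand side of $(X_m)$ if and only if there are elements $a_1,\dots,a_m$ and $b_1,\dots,b_m$ such that $a_i\,\alpha\, b_i$ for $i=0,\dots,m$; $a_m\,\delta\, b_m$; $a_i\,\beta\, a_{i+1}$ and $b_i\,\beta\, b_{i+1}$ for $i$ even, $0\le i\le m-1$; and $a_i\,\gamma\, a_{i+1}$ and $b_i\,\gamma\, b_{i+1}$ for $i$ odd, $0\le i\le m-1$. The right-hand side is described in the same way with $\beta$ and $\gamma$ interchanged. *)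

theory Defs
  imports Main
begin

(* A signature is a partial map: "sg f = Some n" means that f is an operation symbol of
   arity n; symbols outside the domain do not belong to the signature, so that the empty
   signature is covered as well. *)
type_synonym 'f signature = "'f \<rightharpoonup> nat"

datatype 'f trm = Var nat | App 'f "'f trm list"

fun wf_trm :: "'f signature \<Rightarrow> 'f trm \<Rightarrow> bool" where
  "wf_trm sg (Var x) \<longleftrightarrow> True"
| "wf_trm sg (App f ts) \<longleftrightarrow> sg f = Some (length ts) \<and> (\<forall>t\<in>set ts. wf_trm sg t)"

record ('f, 'a) algebra =
  carrier :: "'a set"
  oper :: "'f \<Rightarrow> 'a list \<Rightarrow> 'a"

definition is_algebra :: "'f signature \<Rightarrow> ('f, 'a) algebra \<Rightarrow> bool" where
  "is_algebra sg A \<longleftrightarrow> carrier A \<noteq> {} \<and>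
     (\<forall>f n xs. sg f = Some n \<longrightarrow> length xs = n \<longrightarrow> set xs \<subseteq> carrier A \<longrightarrow>
        oper A f xs \<in> carrier A)"

fun eval :: "('f, 'a) algebra \<Rightarrow> (nat \<Rightarrow> 'a) \<Rightarrow> 'f trm \<Rightarrow> 'a" where
  "eval A v (Var x) = v x"
| "eval A v (App f ts) = oper A f (map (eval A v) ts)"

type_synonym 'f identity = "'f trm \<times> 'f trm"

definition wf_identity :: "'f signature \<Rightarrow> 'f identity \<Rightarrow> bool" where
  "wf_identity sg e \<longleftrightarrow> wf_trm sg (fst e) \<and> wf_trm sg (snd e)"

definition satisfies :: "('f, 'a) algebra \<Rightarrow> 'f identity \<Rightarrow> bool" where
  "satisfies A e \<longleftrightarrow> (\<forall>v. range v \<subseteq> carrier A \<longrightarrow> eval A v (fst e) = eval A v (snd e))"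

(* The algebras of the equational class axiomatized by E whose carrier is a subset of the
   type 'a.  A whole equational class is the family of these sets over all types 'a, which
   cannot be quantified over inside a formula. *)
definition variety :: "'f signature \<Rightarrow> 'f identity set \<Rightarrow> ('f, 'a) algebra set" where
  "variety sg E = {A. is_algebra sg A \<and> (\<forall>e\<in>E. satisfies A e)}"

definition congruence :: "'f signature \<Rightarrow> ('f, 'a) algebra \<Rightarrow> 'a rel \<Rightarrow> bool" where
  "congruence sg A \<theta> \<longleftrightarrow> equiv (carrier A) \<theta> \<and>
     (\<forall>f n xs ys. sg f = Some n \<longrightarrow> length xs = n \<longrightarrow> length ys = n \<longrightarrow>
        (\<forall>i<n. (xs ! i, ys ! i) \<in> \<theta>) \<longrightarrow> (oper A f xs, oper A f ys) \<in> \<theta>)"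

(* alt_comp n \<alpha> \<beta> is the relational product \<alpha> O \<beta> O \<alpha> O ... with n factors;
   the value for n = 0 only serves as the start of the recursion. *)
fun alt_comp :: "nat \<Rightarrow> 'a rel \<Rightarrow> 'a rel \<Rightarrow> 'a rel" where
  "alt_comp 0 \<alpha> \<beta> = Id"
| "alt_comp (Suc n) \<alpha> \<beta> = \<alpha> O alt_comp n \<beta> \<alpha>"

definition m_permute :: "nat \<Rightarrow> 'a rel \<Rightarrow> 'a rel \<Rightarrow> bool" where
  "m_permute m \<alpha> \<beta> \<longleftrightarrow> alt_comp m \<alpha> \<beta> = alt_comp m \<beta> \<alpha>"

definition m_permutable :: "nat \<Rightarrow> 'f signature \<Rightarrow> ('f, 'a) algebra \<Rightarrow> bool" where
  "m_permutable m sg A \<longleftrightarrow>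
     (\<forall>\<alpha> \<beta>. congruence sg A \<alpha> \<longrightarrow> congruence sg A \<beta> \<longrightarrow> m_permute m \<alpha> \<beta>)"

(* nested m \<alpha> \<beta> \<gamma> \<delta> is
     \<alpha> \<inter> (\<beta> O (\<alpha> \<inter> (\<gamma> O (\<alpha> \<inter> (\<beta> O ... (\<alpha> \<inter> \<delta>) ... O \<beta>)) O \<gamma>)) O \<beta>)
   with m nested brackets "\<alpha> \<inter> (...)"; exchanging \<beta> and \<gamma> in the recursive call makes them
   alternate from the outside inwards, starting with \<beta>. *)
fun nested :: "nat \<Rightarrow> 'a rel \<Rightarrow> 'a rel \<Rightarrow> 'a rel \<Rightarrow> 'a rel \<Rightarrow> 'a rel" where
  "nested 0 \<alpha> \<beta> \<gamma> \<delta> = \<alpha> \<inter> \<delta>"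
| "nested (Suc n) \<alpha> \<beta> \<gamma> \<delta> = \<alpha> \<inter> (\<beta> O nested n \<alpha> \<gamma> \<beta> \<delta> O \<beta>)"

definition identity_X :: "nat \<Rightarrow> 'f signature \<Rightarrow> ('f, 'a) algebra \<Rightarrow> bool" where
  "identity_X m sg A \<longleftrightarrow>
     (\<forall>\<alpha> \<beta> \<gamma> \<delta>. congruence sg A \<alpha> \<longrightarrow> congruence sg A \<beta> \<longrightarrow> congruence sg A \<gamma> \<longrightarrow>
        congruence sg A \<delta> \<longrightarrow> nested m \<alpha> \<beta> \<gamma> \<delta> = nested m \<alpha> \<gamma> \<beta> \<delta>)"

(* An equational class being m-permutable can only be expressed one carrier type at a time.
   The type of terms is large enough to contain copies of all countably generated members of
   the class, in particular of its free algebras.  Since only these are required to be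
   m-permutable, this is implied by (and no stronger than) m-permutability of all members. *)
definition m_permutable_variety :: "nat \<Rightarrow> 'f signature \<Rightarrow> 'f identity set \<Rightarrow> bool" where
  "m_permutable_variety m sg E \<longleftrightarrow>
     (\<forall>A \<in> (variety sg E :: ('f, 'f trm) algebra set). m_permutable m sg A)"

end

theory Submission
  imports Defs
begin

text \<open>
  The proof has a syntactic half, in the spirit of Hagemann and Mitschke, and a semantic half.

  Let \<open>F\<close> be the algebra of terms in countably many variables modulo the identities that hold
  in \<open>A\<close>.  It belongs to the variety, so its congruences \<open>m\<close>-permute.  Apply this to the two
  congruences of \<open>F\<close> that identify \<open>x\<^sub>j\<close> with \<open>x\<^sub>j\<^sub>+\<^sub>1\<close> for all even \<open>j\<close>, and for all odd \<open>j\<close>,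
  respectively.  The path \<open>x\<^sub>0, x\<^sub>1, \<dots>, x\<^sub>m\<close> becomes a path
  \<open>x\<^sub>0 = q\<^sub>0, q\<^sub>1, \<dots>, q\<^sub>m = x\<^sub>m\<close> in which the congruences occur in the other order.  As the
  congruence of the step from \<open>q\<^sub>i\<close> to \<open>q\<^sub>i\<^sub>+\<^sub>1\<close> does not mention the pair \<open>(x\<^sub>i, x\<^sub>i\<^sub>+\<^sub>1)\<close>, the terms
  \<open>q\<^sub>i\<close> and \<open>q\<^sub>i\<^sub>+\<^sub>1\<close> take equal values under every valuation that is constant on the variables up
  to \<open>x\<^sub>i\<close> and constant on those from \<open>x\<^sub>i\<^sub>+\<^sub>1\<close> on (\<open>crossing_terms\<close>).

  Now let \<open>a\<^sub>0, \<dots>, a\<^sub>m\<close> and \<open>b\<^sub>0, \<dots>, b\<^sub>m\<close> witness that a pair belongs to the left-hand side.  Let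
  \<open>a'\<^sub>i\<close> be the value of \<open>q\<^sub>i\<close> when \<open>x\<^sub>i\<close> gets the value \<open>a\<^sub>i\<close>, all earlier variables \<open>a\<^sub>i\<^sub>-\<^sub>1\<close>, and
  all later ones \<open>a\<^sub>i\<^sub>+\<^sub>1\<close>.  From \<open>a'\<^sub>i\<close> one reaches \<open>a'\<^sub>i\<^sub>+\<^sub>1\<close> by moving \<open>a\<^sub>i\<^sub>-\<^sub>1\<close> to \<open>a\<^sub>i\<close> in \<open>q\<^sub>i\<close>, replacing
  \<open>q\<^sub>i\<close> by \<open>q\<^sub>i\<^sub>+\<^sub>1\<close> at no cost, and then moving \<open>a\<^sub>i\<^sub>+\<^sub>1\<close> to \<open>a\<^sub>i\<^sub>+\<^sub>2\<close>.  Both moves take place in the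
  congruence that is \<^emph>\<open>not\<close> used between \<open>a\<^sub>i\<close> and \<open>a\<^sub>i\<^sub>+\<^sub>1\<close>, so \<open>\<beta>\<close> and \<open>\<gamma>\<close> have been interchanged
  (\<open>path_shift\<close>), while the end points are still \<open>a\<^sub>0\<close> and \<open>a\<^sub>m\<close>.  Doing the same with
  the \<open>b\<^sub>i\<close> and the same terms keeps the two paths \<open>\<alpha>\<close>-related.
\<close>

section \<open>Paths in place of relational products\<close>

lemma alt_comp_path:
  "(x, y) \<in> alt_comp n R S \<longleftrightarrow>
     (\<exists>q. q 0 = x \<and> q n = y \<and> (\<forall>i<n. (q i, q (Suc i)) \<in> (if even i then R else S)))"
proof (induction n arbitrary: x R S)
  case 0
  show ?case by auto
next
  case (Suc n)
  show ?case
  proof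
    assume "(x, y) \<in> alt_comp (Suc n) R S"
    then obtain z where z: "(x, z) \<in> R" "(z, y) \<in> alt_comp n S R" by auto
    then obtain q where q: "q 0 = z" "q n = y"
      "\<forall>i<n. (q i, q (Suc i)) \<in> (if even i then S else R)"
      using Suc.IH by blast
    have "(case_nat x q i, case_nat x q (Suc i)) \<in> (if even i then R else S)" if "i < Suc n" for i
      using that q z by (cases i) auto
    then show "\<exists>q. q 0 = x \<and> q (Suc n) = y \<and>
        (\<forall>i<Suc n. (q i, q (Suc i)) \<in> (if even i then R else S))"
      using q by (intro exI[of _ "case_nat x q"]) simp
  next
    assume "\<exists>q. q 0 = x \<and> q (Suc n) = y \<and>
        (\<forall>i<Suc n. (q i, q (Suc i)) \<in> (if even i then R else S))"
    then obtain q where q: "q 0 = x" "q (Suc n) = y"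
      "\<And>i. i < Suc n \<Longrightarrow> (q i, q (Suc i)) \<in> (if even i then R else S)" by blast
    have "(q (Suc 0), y) \<in> alt_comp n S R"
      unfolding Suc.IH
    proof (intro exI[of _ "\<lambda>i. q (Suc i)"] conjI allI impI)
      fix i assume "i < n"
      then show "(q (Suc i), q (Suc (Suc i))) \<in> (if even i then S else R)"
        using q(3)[of "Suc i"] by (auto split: if_splits)
    qed (use q in auto)
    moreover have "(x, q (Suc 0)) \<in> R" using q(3)[of 0] q(1) by simp
    ultimately show "(x, y) \<in> alt_comp (Suc n) R S" by auto
  qed
qed

lemma nested_paths:
  assumes "sym \<beta>" "sym \<gamma>"
  shows "(x, y) \<in> nested n \<alpha> \<beta> \<gamma> \<delta> \<longleftrightarrow>
    (\<exists>a b. a 0 = x \<and> b 0 = y \<and> (\<forall>i\<le>n. (a i, b i) \<in> \<alpha>) \<and> (a n, b n) \<in> \<delta> \<and>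
       (\<forall>i<n. (a i, a (Suc i)) \<in> (if even i then \<beta> else \<gamma>) \<and>
              (b i, b (Suc i)) \<in> (if even i then \<beta> else \<gamma>)))"
  using assms
proof (induction n arbitrary: x y \<beta> \<gamma>)
  case 0
  show ?case by (auto intro: exI[of _ "\<lambda>_. x"] exI[of _ "\<lambda>_. y"])
next
  case (Suc n)
  note IH = Suc.IH[OF Suc.prems(2,1)]
  show ?case (is "?L \<longleftrightarrow> ?R")
  proof
    assume ?L
    then obtain z w where zw: "(x, y) \<in> \<alpha>" "(x, z) \<in> \<beta>" "(w, y) \<in> \<beta>"
      "(z, w) \<in> nested n \<alpha> \<gamma> \<beta> \<delta>" by auto
    then obtain a b where ab: "a 0 = z" "b 0 = w" "\<forall>i\<le>n. (a i, b i) \<in> \<alpha>" "(a n, b n) \<in> \<delta>"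
      "\<forall>i<n. (a i, a (Suc i)) \<in> (if even i then \<gamma> else \<beta>) \<and>
             (b i, b (Suc i)) \<in> (if even i then \<gamma> else \<beta>)"
      using IH by blast
    have yw: "(y, w) \<in> \<beta>" using zw Suc.prems(1) by (auto dest: symD)
    have 1: "(case_nat x a i, case_nat y b i) \<in> \<alpha>" if "i \<le> Suc n" for i
      using that ab zw by (cases i) auto
    have 2: "(case_nat x a i, case_nat x a (Suc i)) \<in> (if even i then \<beta> else \<gamma>) \<and>
             (case_nat y b i, case_nat y b (Suc i)) \<in> (if even i then \<beta> else \<gamma>)"
      if "i < Suc n" for i
      using that ab zw yw by (cases i) auto
    show ?R
      using 1 2 ab(4) by (intro exI[of _ "case_nat x a"] exI[of _ "case_nat y b"]) simp
  next
    assume ?R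
    then obtain a b where ab: "a 0 = x" "b 0 = y" "\<And>i. i \<le> Suc n \<Longrightarrow> (a i, b i) \<in> \<alpha>"
      "(a (Suc n), b (Suc n)) \<in> \<delta>"
      "\<And>i. i < Suc n \<Longrightarrow> (a i, a (Suc i)) \<in> (if even i then \<beta> else \<gamma>) \<and>
             (b i, b (Suc i)) \<in> (if even i then \<beta> else \<gamma>)" by blast
    have "(a (Suc 0), b (Suc 0)) \<in> nested n \<alpha> \<gamma> \<beta> \<delta>"
      unfolding IH
    proof (rule exI[of _ "\<lambda>i. a (Suc i)"], rule exI[of _ "\<lambda>i. b (Suc i)"], intro conjI allI impI)
      fix i assume "i < n"
      then have "(a (Suc i), a (Suc (Suc i))) \<in> (if even i then \<gamma> else \<beta>) \<and>
        (b (Suc i), b (Suc (Suc i))) \<in> (if even i then \<gamma> else \<beta>)"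
        using ab(5)[of "Suc i"] by (auto split: if_splits)
      then show "(a (Suc i), a (Suc (Suc i))) \<in> (if even i then \<gamma> else \<beta>)"
        and "(b (Suc i), b (Suc (Suc i))) \<in> (if even i then \<gamma> else \<beta>)"
        by blast+
    qed (use ab in auto)
    moreover have "(x, a (Suc 0)) \<in> \<beta>" "(b (Suc 0), y) \<in> \<beta>" "(x, y) \<in> \<alpha>"
      using ab(5)[of 0] ab(1,2) ab(3)[of 0] Suc.prems(1) by (auto dest: symD)
    ultimately show ?L by auto
  qed
qed

section \<open>Terms, substitution and congruences\<close>

fun subst :: "(nat \<Rightarrow> 'f trm) \<Rightarrow> 'f trm \<Rightarrow> 'f trm" where
  "subst \<sigma> (Var x) = \<sigma> x"
| "subst \<sigma> (App f ts) = App f (map (subst \<sigma>) ts)"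

lemma wf_subst: "wf_trm sg t \<Longrightarrow> (\<And>x. wf_trm sg (\<sigma> x)) \<Longrightarrow> wf_trm sg (subst \<sigma> t)"
  by (induction t) auto

lemma eval_subst: "eval A v (subst \<sigma> t) = eval A (\<lambda>x. eval A v (\<sigma> x)) t"
proof (induction t)
  case (App f ts)
  then show ?case by (simp add: o_def cong: map_cong)
qed simp

lemma is_algebra_oper:
  assumes "is_algebra sg A" "sg f = Some (length xs)" "set xs \<subseteq> carrier A"
  shows "oper A f xs \<in> carrier A"
  using assms unfolding is_algebra_def by blast

lemma eval_in_carrier:
  assumes "is_algebra sg A" "range v \<subseteq> carrier A" "wf_trm sg t"
  shows "eval A v t \<in> carrier A"
  using assms(3)
proof (induction t)
  case (Var x)
  then show ?case using assms(2) by auto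
next
  case (App f ts)
  then show ?case
    using assms(1) by (auto intro!: is_algebra_oper)
qed

lemma congruence_eval:
  assumes "congruence sg A \<theta>" "\<And>x. (v x, w x) \<in> \<theta>" "wf_trm sg t"
  shows "(eval A v t, eval A w t) \<in> \<theta>"
  using assms(3)
proof (induction t)
  case (Var x)
  then show ?case using assms(2) by simp
next
  case (App f ts)
  have "\<forall>i<length ts. (map (eval A v) ts ! i, map (eval A w) ts ! i) \<in> \<theta>"
    using App by auto
  then show ?case
    using assms(1) App.prems unfolding congruence_def by simp
qed

lemma congruence_refl: "congruence sg A \<theta> \<Longrightarrow> x \<in> carrier A \<Longrightarrow> (x, x) \<in> \<theta>"
  unfolding congruence_def equiv_def refl_on_def by blast

lemma congruence_sym: "congruence sg A \<theta> \<Longrightarrow> sym \<theta>"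
  unfolding congruence_def equiv_def by blast

lemma congruence_trans: "congruence sg A \<theta> \<Longrightarrow> trans \<theta>"
  unfolding congruence_def equiv_def by blast

lemma congruence_carrier:
  "congruence sg A \<theta> \<Longrightarrow> (x, y) \<in> \<theta> \<Longrightarrow> x \<in> carrier A \<and> y \<in> carrier A"
  unfolding congruence_def by (meson equiv_class_eq_iff)

section \<open>The algebra of terms modulo the identities of an algebra\<close>

text \<open>
  Choosing one term from each class of terms that agree everywhere on \<open>A\<close> makes the quotient of
  the term algebra an algebra whose elements are terms again.  Taking the identities of the one
  algebra \<open>A\<close>, instead of those of the whole variety, suffices and spares a calculus of
  equational deduction.
\<close>

definition normal_form :: "'f signature \<Rightarrow> ('f, 'a) algebra \<Rightarrow> 'f trm \<Rightarrow> 'f trm" where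
  "normal_form sg A t =
     (SOME s. wf_trm sg s \<and> (\<forall>v. range v \<subseteq> carrier A \<longrightarrow> eval A v s = eval A v t))"

definition free_algebra :: "'f signature \<Rightarrow> ('f, 'a) algebra \<Rightarrow> ('f, 'f trm) algebra" where
  "free_algebra sg A =
     \<lparr>carrier = normal_form sg A ` {t. wf_trm sg t}, oper = \<lambda>f ts. normal_form sg A (App f ts)\<rparr>"

lemma normal_form:
  assumes "wf_trm sg t"
  shows wf_normal_form: "wf_trm sg (normal_form sg A t)"
    and eval_normal_form: "range v \<subseteq> carrier A \<Longrightarrow> eval A v (normal_form sg A t) = eval A v t"
proof -
  have "wf_trm sg (normal_form sg A t) \<and>
      (\<forall>v. range v \<subseteq> carrier A \<longrightarrow> eval A v (normal_form sg A t) = eval A v t)"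
    unfolding normal_form_def
    by (rule someI[where x = t]) (use assms in simp)
  then show "wf_trm sg (normal_form sg A t)"
    and "range v \<subseteq> carrier A \<Longrightarrow> eval A v (normal_form sg A t) = eval A v t" by blast+
qed

lemma normal_form_cong:
  assumes "\<And>v. range v \<subseteq> carrier A \<Longrightarrow> eval A v s = eval A v t"
  shows "normal_form sg A s = normal_form sg A t"
  unfolding normal_form_def using assms by metis

lemma wf_free_carrier: "t \<in> carrier (free_algebra sg A) \<Longrightarrow> wf_trm sg t"
  by (auto simp: free_algebra_def wf_normal_form)

lemma normal_form_in_free:
  "wf_trm sg t \<Longrightarrow> normal_form sg A t \<in> carrier (free_algebra sg A)"
  by (simp add: free_algebra_def)

lemma normal_form_free:
  assumes "t \<in> carrier (free_algebra sg A)"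
  shows "normal_form sg A t = t"
proof -
  from assms obtain s where "wf_trm sg s" "t = normal_form sg A s"
    by (auto simp: free_algebra_def)
  then show ?thesis by (auto intro: normal_form_cong simp: eval_normal_form)
qed

lemma eval_free_oper:
  assumes "sg f = Some (length ts)" "set ts \<subseteq> carrier (free_algebra sg A)"
    "range v \<subseteq> carrier A"
  shows "eval A v (oper (free_algebra sg A) f ts) = oper A f (map (eval A v) ts)"
proof -
  have "wf_trm sg (App f ts)" using assms wf_free_carrier by fastforce
  then show ?thesis using assms(3) by (simp add: free_algebra_def eval_normal_form)
qed

lemma is_algebra_free: "is_algebra sg (free_algebra sg A)"
  unfolding is_algebra_def
proof (intro conjI allI impI)
  show "carrier (free_algebra sg A) \<noteq> {}"
    using normal_form_in_free[of sg "Var 0"] by auto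
next
  fix f n and ts :: "'a trm list"
  assume "sg f = Some n" "length ts = n" "set ts \<subseteq> carrier (free_algebra sg A)"
  then have "wf_trm sg (App f ts)" using wf_free_carrier by fastforce
  then show "oper (free_algebra sg A) f ts \<in> carrier (free_algebra sg A)"
    by (simp add: free_algebra_def del: wf_trm.simps)
qed

lemma eval_free:
  fixes A :: "('f, 'b) algebra"
  assumes "range \<sigma> \<subseteq> carrier (free_algebra sg A)" "wf_trm sg t"
  shows "eval (free_algebra sg A) \<sigma> t = normal_form sg A (subst \<sigma> t)"
  using assms(2)
proof (induction t)
  case (Var x)
  have "\<sigma> x \<in> carrier (free_algebra sg A)" using assms(1) by auto
  then show ?case by (simp add: normal_form_free)
next
  case (App f ts)
  have wf: "wf_trm sg (subst \<sigma> t)" if "t \<in> set ts" for t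
    using App.prems assms(1) that by (intro wf_subst) (auto intro: wf_free_carrier)
  have "map (eval (free_algebra sg A) \<sigma>) ts = map (\<lambda>t. normal_form sg A (subst \<sigma> t)) ts"
    using App by simp
  then have "eval (free_algebra sg A) \<sigma> (App f ts) =
      normal_form sg A (App f (map (\<lambda>t. normal_form sg A (subst \<sigma> t)) ts))"
    by (simp add: free_algebra_def[of sg A] cong: map_cong)
  also have "\<dots> = normal_form sg A (subst \<sigma> (App f ts))"
  proof (rule normal_form_cong)
    fix v :: "nat \<Rightarrow> 'b" assume v: "range v \<subseteq> carrier A"
    have "map (eval A v) (map (\<lambda>t. normal_form sg A (subst \<sigma> t)) ts) =
        map (eval A v) (map (subst \<sigma>) ts)"
      using wf v by (simp add: eval_normal_form)
    then show "eval A v (App f (map (\<lambda>t. normal_form sg A (subst \<sigma> t)) ts)) =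
        eval A v (subst \<sigma> (App f ts))"
      by (simp only: eval.simps subst.simps)
  qed
  finally show ?case .
qed

text \<open>
  An identity of \<open>A\<close> remains one after substitution, which says precisely that it holds in the
  quotient of the term algebra.
\<close>

lemma free_algebra_in_variety:
  fixes A :: "('f, 'a) algebra"
  assumes "A \<in> variety sg E" "\<forall>e\<in>E. wf_identity sg e"
  shows "free_algebra sg A \<in> variety sg E"
proof -
  have "satisfies (free_algebra sg A) e" if e: "e \<in> E" for e
    unfolding satisfies_def
  proof (intro allI impI)
    fix \<sigma> :: "nat \<Rightarrow> 'f trm"
    assume \<sigma>: "range \<sigma> \<subseteq> carrier (free_algebra sg A)"
    have wf: "wf_trm sg (fst e)" "wf_trm sg (snd e)"
      using assms(2) e by (auto simp: wf_identity_def)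
    have alg: "is_algebra sg A" and sat: "satisfies A e"
      using assms(1) e by (auto simp: variety_def)
    have "normal_form sg A (subst \<sigma> (fst e)) = normal_form sg A (subst \<sigma> (snd e))"
    proof (rule normal_form_cong)
      fix v :: "nat \<Rightarrow> 'a" assume v: "range v \<subseteq> carrier A"
      have "range (\<lambda>x. eval A v (\<sigma> x)) \<subseteq> carrier A"
        using \<sigma> v alg by (auto intro!: eval_in_carrier wf_free_carrier)
      then show "eval A v (subst \<sigma> (fst e)) = eval A v (subst \<sigma> (snd e))"
        using sat by (simp add: eval_subst satisfies_def)
    qed
    then show "eval (free_algebra sg A) \<sigma> (fst e) = eval (free_algebra sg A) \<sigma> (snd e)"
      using \<sigma> wf by (simp add: eval_free)
  qed
  then show ?thesis by (simp add: variety_def is_algebra_free)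
qed

section \<open>The connecting terms\<close>

text \<open>
  For \<open>P\<close> the valuations with \<open>v x = v y\<close> this contains the pair of variables \<open>x\<close>, \<open>y\<close>.  It
  serves as the congruence generated by such pairs: it is visibly a congruence, and
  membership in it says directly which values of the two terms coincide.
\<close>

definition agreement ::
  "'f signature \<Rightarrow> ('f, 'a) algebra \<Rightarrow> ((nat \<Rightarrow> 'a) \<Rightarrow> bool) \<Rightarrow> 'f trm rel" where
  "agreement sg A P = {(s, t). s \<in> carrier (free_algebra sg A) \<and> t \<in> carrier (free_algebra sg A) \<and>
     (\<forall>v. range v \<subseteq> carrier A \<longrightarrow> P v \<longrightarrow> eval A v s = eval A v t)}"

lemma congruence_agreement: "congruence sg (free_algebra sg A) (agreement sg A P)"
  unfolding congruence_def
proof (intro conjI allI impI)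
  show "equiv (carrier (free_algebra sg A)) (agreement sg A P)"
    by (rule equivI) (auto simp: agreement_def refl_on_def sym_def trans_def)
next
  fix f n ss ts
  assume *: "sg f = Some n" "length ss = n" "length ts = n"
    "\<forall>i<n. (ss ! i, ts ! i) \<in> agreement sg A P"
  have ss: "set ss \<subseteq> carrier (free_algebra sg A)" and ts: "set ts \<subseteq> carrier (free_algebra sg A)"
    using * by (auto simp: agreement_def in_set_conv_nth)
  have "eval A v (oper (free_algebra sg A) f ss) = eval A v (oper (free_algebra sg A) f ts)"
    if v: "range v \<subseteq> carrier A" "P v" for v
  proof -
    have "map (eval A v) ss = map (eval A v) ts"
      using * v by (auto simp: agreement_def intro!: nth_equalityI)
    then show ?thesis using * ss ts v by (simp add: eval_free_oper)
  qed
  then show "(oper (free_algebra sg A) f ss, oper (free_algebra sg A) f ts) \<in> agreement sg A P"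
    using * ss ts by (simp add: agreement_def is_algebra_oper[OF is_algebra_free])
qed

text \<open>
  The terms \<open>q i\<close> come from permuting the path \<open>x\<^sub>0, \<dots>, x\<^sub>m\<close> of variables.  Reading \<open>q i\<close> with
  the variables before \<open>x\<^sub>i\<close> identified, and those after \<open>x\<^sub>i\<close> identified, yields the ternary
  terms of Hagemann and Mitschke; keeping all the variables makes the end points
  \<open>i = 0\<close> and \<open>i = m\<close> uniform with the rest.
\<close>

lemma crossing_terms:
  assumes A: "A \<in> variety sg E" and E: "\<forall>e\<in>E. wf_identity sg e"
    and perm: "m_permutable_variety m sg E"
  obtains q where "\<And>i. i \<le> m \<Longrightarrow> wf_trm sg (q i)"
    and "\<And>v. range v \<subseteq> carrier A \<Longrightarrow> eval A v (q 0) = v 0"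
    and "\<And>v. range v \<subseteq> carrier A \<Longrightarrow> eval A v (q m) = v m"
    and "\<And>i v. i < m \<Longrightarrow> range v \<subseteq> carrier A \<Longrightarrow> (\<And>j. j \<noteq> i \<Longrightarrow> v (Suc j) = v j) \<Longrightarrow>
           eval A v (q i) = eval A v (q (Suc i))"
proof -
  let ?R = "\<lambda>b. agreement sg A (\<lambda>v. \<forall>j. even j = b \<longrightarrow> v (Suc j) = v j)"
  let ?x = "\<lambda>j. normal_form sg A (Var j)"
  have x: "?x j \<in> carrier (free_algebra sg A)" for j
    by (simp add: normal_form_in_free)
  have eval_x: "eval A v (?x j) = v j" if "range v \<subseteq> carrier A" for v j
    using that by (simp add: eval_normal_form)
  have "m_permute m (?R True) (?R False)"
    using perm free_algebra_in_variety[OF A E] congruence_agreement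
    unfolding m_permutable_variety_def m_permutable_def by blast
  then have swap: "alt_comp m (?R True) (?R False) = alt_comp m (?R False) (?R True)"
    by (simp add: m_permute_def)
  have "(?x j, ?x (Suc j)) \<in> (if even j then ?R True else ?R False)" for j
    using x by (simp add: agreement_def eval_x)
  then have "(?x 0, ?x m) \<in> alt_comp m (?R True) (?R False)"
    unfolding alt_comp_path by (intro exI[of _ ?x]) simp
  then have "(?x 0, ?x m) \<in> alt_comp m (?R False) (?R True)"
    by (simp only: swap)
  then obtain q where q0: "q 0 = ?x 0" and qm: "q m = ?x m"
    and q: "\<And>i. i < m \<Longrightarrow> (q i, q (Suc i)) \<in> (if even i then ?R False else ?R True)"
    unfolding alt_comp_path by blast
  show thesis
  proof (rule that[of q])
    fix i assume "i \<le> m"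
    then consider "i = m" | "i < m" by linarith
    then show "wf_trm sg (q i)"
    proof cases
      case 1
      then show ?thesis using qm x wf_free_carrier by metis
    next
      case 2
      then have "q i \<in> carrier (free_algebra sg A)"
        using q[OF 2] by (auto simp: agreement_def split: if_splits)
      then show ?thesis by (rule wf_free_carrier)
    qed
  next
    fix i and v :: "nat \<Rightarrow> 'b"
    assume i: "i < m" and v: "range v \<subseteq> carrier A" "\<And>j. j \<noteq> i \<Longrightarrow> v (Suc j) = v j"
    have "\<forall>j. even j = odd i \<longrightarrow> v (Suc j) = v j"
      using v(2) by metis
    then show "eval A v (q i) = eval A v (q (Suc i))"
      using q[OF i] v(1) by (auto simp: agreement_def split: if_splits)
  qed (simp_all add: q0 qm eval_x)
qed

section \<open>Interchanging the two congruences along a path\<close>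

text \<open>
  The valuation used for the \<open>i\<close>-th term of the new path: the index \<open>j\<close> is clamped to the interval
  from \<open>i - 1\<close> to \<open>i + 1\<close>.  Truncated subtraction makes \<open>i - 1 = i\<close> for \<open>i = 0\<close>, where there is no
  earlier variable.
\<close>

definition window :: "(nat \<Rightarrow> 'a) \<Rightarrow> nat \<Rightarrow> nat \<Rightarrow> 'a" where
  "window a i j = a (max (i - 1) (min j (Suc i)))"

lemma path_shift:
  assumes \<beta>: "congruence sg A \<beta>" and \<gamma>: "congruence sg A \<gamma>"
    and wf: "wf_trm sg s" "wf_trm sg t"
    and st: "\<And>v. range v \<subseteq> carrier A \<Longrightarrow> (\<And>j. j \<noteq> i \<Longrightarrow> v (Suc j) = v j) \<Longrightarrow>
               eval A v s = eval A v t"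
    and a: "range a \<subseteq> carrier A"
    and path: "\<And>i. (a i, a (Suc i)) \<in> (if even i then \<beta> else \<gamma>)"
  shows "(eval A (window a i) s, eval A (window a (Suc i)) t) \<in> (if even i then \<gamma> else \<beta>)"
proof -
  let ?\<theta> = "if even i then \<gamma> else \<beta>"
  \<comment> \<open>Of all the steps, this valuation keeps only the one from \<open>a i\<close> to \<open>a (i + 1)\<close>, so \<open>s\<close> and \<open>t\<close>
      take the same value under it.\<close>
  let ?u = "\<lambda>j. if j \<le> i then a i else a (Suc i)"
  have \<theta>: "congruence sg A ?\<theta>" using \<beta> \<gamma> by simp
  have aC: "a j \<in> carrier A" for j using a by auto
  have before: "(window a i j, ?u j) \<in> ?\<theta>" for j
  proof (cases "j < i")
    case True
    then obtain k where k: "i = Suc k" by (cases i) auto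
    have "(a k, a (Suc k)) \<in> ?\<theta>" using path[of k] k by (auto split: if_splits)
    moreover have "window a i j = a k" using True k by (simp add: window_def)
    ultimately show ?thesis using True k by simp
  next
    case False
    then have "j = i \<or> Suc i \<le> j" by linarith
    then have "window a i j = ?u j"
      by (auto simp: window_def)
    then show ?thesis using congruence_refl[OF \<theta>] aC by simp
  qed
  have after: "(?u j, window a (Suc i) j) \<in> ?\<theta>" for j
  proof (cases "j > Suc i")
    case True
    have "(a (Suc i), a (Suc (Suc i))) \<in> ?\<theta>" using path[of "Suc i"] by (auto split: if_splits)
    moreover have "window a (Suc i) j = a (Suc (Suc i))" using True by (simp add: window_def)
    ultimately show ?thesis using True by simp
  next
    case False
    then have "j = Suc i \<or> j \<le> i" by linarith
    then have "window a (Suc i) j = ?u j"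
      by (auto simp: window_def)
    then show ?thesis using congruence_refl[OF \<theta>] aC by simp
  qed
  have "(eval A (window a i) s, eval A ?u s) \<in> ?\<theta>"
    using congruence_eval[OF \<theta> before wf(1)] .
  moreover have "eval A ?u s = eval A ?u t"
    using aC by (intro st) auto
  moreover have "(eval A ?u t, eval A (window a (Suc i)) t) \<in> ?\<theta>"
    using congruence_eval[OF \<theta> after wf(2)] .
  ultimately show ?thesis
    using congruence_trans[OF \<theta>] by (simp only: trans_def)
qed

lemma nested_swap_subset:
  assumes A: "A \<in> variety sg E" and E: "\<forall>e\<in>E. wf_identity sg e"
    and perm: "m_permutable_variety m sg E"
    and \<alpha>: "congruence sg A \<alpha>" and \<beta>: "congruence sg A \<beta>" and \<gamma>: "congruence sg A \<gamma>"
  shows "nested m \<alpha> \<beta> \<gamma> \<delta> \<subseteq> nested m \<alpha> \<gamma> \<beta> \<delta>"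
proof (rule subrelI)
  fix x y assume "(x, y) \<in> nested m \<alpha> \<beta> \<gamma> \<delta>"
  then obtain a0 b0 where a0: "a0 0 = x" "b0 0 = y" "\<And>i. i \<le> m \<Longrightarrow> (a0 i, b0 i) \<in> \<alpha>"
    "(a0 m, b0 m) \<in> \<delta>"
    "\<And>i. i < m \<Longrightarrow> (a0 i, a0 (Suc i)) \<in> (if even i then \<beta> else \<gamma>)"
    "\<And>i. i < m \<Longrightarrow> (b0 i, b0 (Suc i)) \<in> (if even i then \<beta> else \<gamma>)"
    unfolding nested_paths[OF congruence_sym[OF \<beta>] congruence_sym[OF \<gamma>]] by blast
  \<comment> \<open>Past \<open>m\<close> the paths stay at their last vertex, so that \<open>window\<close> is meaningful at \<open>i = m\<close> too.\<close>
  define a where "a i = a0 (min i m)" for i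
  define b where "b i = b0 (min i m)" for i
  have ab: "(a i, b i) \<in> \<alpha>" for i
    using a0(3) by (simp add: a_def b_def)
  have aC: "range a \<subseteq> carrier A" and bC: "range b \<subseteq> carrier A"
    using congruence_carrier[OF \<alpha> ab] by auto
  have stay: "(c, c) \<in> (if even i then \<beta> else \<gamma>)" if "c \<in> carrier A" for c and i :: nat
    using that congruence_refl \<beta> \<gamma> by (metis (full_types))
  have pa: "(a i, a (Suc i)) \<in> (if even i then \<beta> else \<gamma>)" for i
  proof (cases "i < m")
    case True
    then show ?thesis using a0(5)[OF True] by (simp add: a_def)
  next
    case False
    then have "a (Suc i) = a i" by (simp add: a_def)
    then show ?thesis using stay[of "a i" i] aC by (simp only: range_subsetD)
  qed
  have pb: "(b i, b (Suc i)) \<in> (if even i then \<beta> else \<gamma>)" for i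
  proof (cases "i < m")
    case True
    then show ?thesis using a0(6)[OF True] by (simp add: b_def)
  next
    case False
    then have "b (Suc i) = b i" by (simp add: b_def)
    then show ?thesis using stay[of "b i" i] bC by (simp only: range_subsetD)
  qed
  obtain q where q_wf: "\<And>i. i \<le> m \<Longrightarrow> wf_trm sg (q i)"
    and q0: "\<And>v. range v \<subseteq> carrier A \<Longrightarrow> eval A v (q 0) = v 0"
    and qm: "\<And>v. range v \<subseteq> carrier A \<Longrightarrow> eval A v (q m) = v m"
    and q: "\<And>i v. i < m \<Longrightarrow> range v \<subseteq> carrier A \<Longrightarrow> (\<And>j. j \<noteq> i \<Longrightarrow> v (Suc j) = v j) \<Longrightarrow>
           eval A v (q i) = eval A v (q (Suc i))"
    using crossing_terms[OF A E perm] by blast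
  let ?a = "\<lambda>i. eval A (window a i) (q i)" and ?b = "\<lambda>i. eval A (window b i) (q i)"
  have win: "range (window c i) \<subseteq> carrier A" if "range c \<subseteq> carrier A" for c i
    using that by (auto simp: window_def)
  have ends: "eval A (window c 0) (q 0) = c 0" "eval A (window c m) (q m) = c m"
    if "range c \<subseteq> carrier A" for c
    using q0[OF win[OF that]] qm[OF win[OF that]] by (simp_all add: window_def)
  show "(x, y) \<in> nested m \<alpha> \<gamma> \<beta> \<delta>"
    unfolding nested_paths[OF congruence_sym[OF \<gamma>] congruence_sym[OF \<beta>]]
  proof (rule exI[of _ ?a], rule exI[of _ ?b], intro conjI allI impI)
    show "?a 0 = x" "?b 0 = y" "(?a m, ?b m) \<in> \<delta>"
      using a0(1,2,4) by (simp_all add: ends aC bC) (simp_all add: a_def b_def)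
  next
    fix i assume "i \<le> m"
    then show "(?a i, ?b i) \<in> \<alpha>"
      using ab by (intro congruence_eval[OF \<alpha>] q_wf) (simp add: window_def)
  next
    fix i assume i: "i < m"
    show "(?a i, ?a (Suc i)) \<in> (if even i then \<gamma> else \<beta>)"
      by (rule path_shift[OF \<beta> \<gamma> _ _ q[OF i] aC pa]) (use i q_wf in auto)
    show "(?b i, ?b (Suc i)) \<in> (if even i then \<gamma> else \<beta>)"
      by (rule path_shift[OF \<beta> \<gamma> _ _ q[OF i] bC pb]) (use i q_wf in auto)
  qed
qed

theorem theorem4:
  fixes m :: nat
    and sg :: "'f signature"
    and E :: "'f identity set"
    and A :: "('f, 'a) algebra"
  assumes "m \<ge> 1"
    and "\<forall>e\<in>E. wf_identity sg e"
    and "m_permutable_variety m sg E"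
    and "A \<in> variety sg E"
  shows "identity_X m sg A"
  unfolding identity_X_def
  using nested_swap_subset[OF assms(4,2,3)] by (simp add: subset_antisym)

end
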